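(* Let $f:\mathbb{R}^n\to\mathbb{R}^n$ and $g:\mathbb{R}^n\to\mathbb{R}^{n\times m}$ be continuous, let $\varepsilon\in(0,1)$, $\alpha\in[0,1]$, let $\Sigma_w\in\mathbb{R}^{n\times n}$ be symmetric positive definite, and let $\mathcal{P}$ be the set of all probability distributions on $\mathbb{R}^n$ with mean $0$ and covariance matrix $\Sigma_w$. Let $E\in\mathbb{R}^{n\times n}$ with $E=E^\top\succ0$, $r\in\mathbb{R}$, and $h(x)=-x^\top Ex+r$. For $x\in\mathbb{R}^n$ and $u\in\mathbb{R}^m$, write $x^+=f(x)+g(x)u+w$, where $w$ is a random vector in $\mathbb{R}^n$ with law $\mathbb{P}\in\mathcal{P}$. Let $x\in\mathbb{R}^n$, $u\in\mathbb{R}^m$, $v\in\mathbb{R}^n$ and $\bar u=[u^\top,v^\top]^\top\in\mathbb{R}^{m+n}$. If 1) $\bar u^\top\bar H(x)\bar u+\bar q(x)^\top\bar u+\bar r(x)\le0$, and 2) $\bar A(x)\bar u\le0$ (element-wise), where $$\bar H(x)=\begin{bmatrix}g(x)^\top Eg(x)&0\\0&0\end{bmatrix},\qquad \bar q(x)=2\begin{bmatrix}g(x)^\top Ef(x)\\ \sup_{\mathbb{P}\in\mathcal{P}}\mathbb{P}\text{-CVaR}_{\varepsilon}[w]\end{bmatrix},$$ $$\bar r(x)=\sup_{\mathbb{P}\in\mathcal{P}}\mathbb{P}\text{-CVaR}_{\varepsilon}\big[w^\top Ew+(2Ef(x))^\top w\big]+f(x)^\top Ef(x)-r-\alpha(x^\top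 Ex-r),$$ $$\bar A(x)=\begin{bmatrix}Eg(x)&-I_n\\-Eg(x)&-I_n\end{bmatrix},$$ then $$\sup_{\mathbb{P}\in\mathcal{P}}\mathbb{P}\text{-CVaR}_{\varepsilon}[-h(x^+)]\le-\alpha h(x).$$
   Context: For a measurable loss function $L:\mathbb{R}^n\to\mathbb{R}$, a probability distribution $\mathbb{P}$ on $\mathbb{R}^n$ (the law of the random vector $w$) and a level $\varepsilon\in(0,1)$, the Conditional Value-at-Risk is $$\mathbb{P}\text{-CVaR}_{\varepsilon}[L(w)]=\inf_{\beta\in\mathbb{R}}\left\{\beta+\frac1\varepsilon\,\mathbb{E}_{\mathbb{P}}\big[(L(w)-\beta)^+\big]\right\},$$ where $(a)^+=\max(a,0)$. The worst-case CVaR over $\mathcal{P}$ is the supremum of this quantity over $\mathbb{P}\in\mathcal{P}$. For the vector $w=(w_1,\dots,w_n)^\top$, $\sup_{\mathbb{P}\in\mathcal{P}}\mathbb{P}\text{-CVaR}_\varepsilon[w]$ is the vector in $\mathbb{R}^n$ whose $i$-th entry is $\sup_{\mathbb{P}\in\mathcal{P}}\mathbb{P}\text{-CVaR}_\varepsilon[w_i]$. In $\text{CVaR}_\varepsilon[-h(x^+)]$ the vectors $x,u$ are deterministic and only $w$ is random. *)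

theory Defs
  imports "HOL-Probability.Probability"
begin

definition pos_def :: "real^'n^'n \<Rightarrow> bool" where
  "pos_def A \<longleftrightarrow> transpose A = A \<and> (\<forall>y. y \<noteq> 0 \<longrightarrow> 0 < y \<bullet> (A *v y))"

definition has_mean :: "(real^'n) measure \<Rightarrow> real^'n \<Rightarrow> bool" where
  "has_mean P \<mu> \<longleftrightarrow> integrable P (\<lambda>w. w) \<and> (\<integral>w. w \<partial>P) = \<mu>"

definition has_covariance :: "(real^'n) measure \<Rightarrow> real^'n^'n \<Rightarrow> bool" where
  "has_covariance P \<Sigma> \<longleftrightarrow>
     (let \<mu> = (\<integral>w. w \<partial>P) in
      \<forall>i j. integrable P (\<lambda>w. (w $ i - \<mu> $ i) * (w $ j - \<mu> $ j)) \<and>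
            (\<integral>w. (w $ i - \<mu> $ i) * (w $ j - \<mu> $ j) \<partial>P) = \<Sigma> $ i $ j)"

definition ambiguity_set :: "real^'n^'n \<Rightarrow> (real^'n) measure set" where
  "ambiguity_set \<Sigma> =
     {P. prob_space P \<and> sets P = sets borel \<and> has_mean P 0 \<and> has_covariance P \<Sigma>}"

(* Extended-real valued, so that an infinite expectation or an unbounded infimum
   is represented as such.  The function ennreal maps negative reals to 0, but
   its argument here is nonnegative. *)
definition CVaR :: "'a measure \<Rightarrow> real \<Rightarrow> ('a \<Rightarrow> real) \<Rightarrow> ereal" where
  "CVaR P \<epsilon> L =
     (INF \<beta>::real. ereal \<beta> +
        ereal (1 / \<epsilon>) * enn2ereal (\<integral>\<^sup>+w. ennreal (max (L w - \<beta>) 0) \<partial>P))"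

definition worst_CVaR :: "'a measure set \<Rightarrow> real \<Rightarrow> ('a \<Rightarrow> real) \<Rightarrow> ereal" where
  "worst_CVaR \<P> \<epsilon> L = (SUP P\<in>\<P>. CVaR P \<epsilon> L)"

(* Linear and quadratic losses have finite worst-case CVaR over ambiguity_set,
   because all first and second moments are fixed there; the conversions by
   real_of_ereal here and in r_bar therefore lose nothing. *)
definition worst_CVaR_vec :: "(real^'n) measure set \<Rightarrow> real \<Rightarrow> real^'n" where
  "worst_CVaR_vec \<P> \<epsilon> = (\<chi> i. real_of_ereal (worst_CVaR \<P> \<epsilon> (\<lambda>w. w $ i)))"

(* Concatenated vectors and block matrices are indexed by sum types, Inl indices first. *)
definition vec_concat :: "'a^'m \<Rightarrow> 'a^'n \<Rightarrow> 'a^('m + 'n)" where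
  "vec_concat a b = (\<chi> k. case k of Inl i \<Rightarrow> a $ i | Inr j \<Rightarrow> b $ j)"

definition block_mat ::
  "'a^'c^'p \<Rightarrow> 'a^'d^'p \<Rightarrow> 'a^'c^'q \<Rightarrow> 'a^'d^'q \<Rightarrow> 'a^('c + 'd)^('p + 'q)" where
  "block_mat A B C D =
     (\<chi> k. case k of Inl i \<Rightarrow> vec_concat (A $ i) (B $ i) | Inr j \<Rightarrow> vec_concat (C $ j) (D $ j))"

definition h_fun :: "real^'n^'n \<Rightarrow> real \<Rightarrow> real^'n \<Rightarrow> real" where
  "h_fun E r x = - (x \<bullet> (E *v x)) + r"

definition H_bar ::
  "(real^'n \<Rightarrow> real^'m^'n) \<Rightarrow> real^'n^'n \<Rightarrow> real^'n \<Rightarrow> real^('m + 'n)^('m + 'n)" where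
  "H_bar g E x = block_mat (transpose (g x) ** E ** g x) 0 0 0"

definition q_bar ::
  "(real^'n \<Rightarrow> real^'n) \<Rightarrow> (real^'n \<Rightarrow> real^'m^'n) \<Rightarrow> real^'n^'n \<Rightarrow> (real^'n) measure set \<Rightarrow>
   real \<Rightarrow> real^'n \<Rightarrow> real^('m + 'n)" where
  "q_bar f g E \<P> \<epsilon> x =
     2 *\<^sub>R vec_concat (transpose (g x) *v (E *v f x)) (worst_CVaR_vec \<P> \<epsilon>)"

definition r_bar ::
  "(real^'n \<Rightarrow> real^'n) \<Rightarrow> real^'n^'n \<Rightarrow> real \<Rightarrow> real \<Rightarrow> (real^'n) measure set \<Rightarrow>
   real \<Rightarrow> real^'n \<Rightarrow> real" where
  "r_bar f E r \<alpha> \<P> \<epsilon> x =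
     real_of_ereal (worst_CVaR \<P> \<epsilon> (\<lambda>w. w \<bullet> (E *v w) + (2 *\<^sub>R (E *v f x)) \<bullet> w))
     + f x \<bullet> (E *v f x) - r - \<alpha> * (x \<bullet> (E *v x) - r)"

definition A_bar ::
  "(real^'n \<Rightarrow> real^'m^'n) \<Rightarrow> real^'n^'n \<Rightarrow> real^'n \<Rightarrow> real^('m + 'n)^('n + 'n)" where
  "A_bar g E x = block_mat (E ** g x) (- mat 1) (- (E ** g x)) (- mat 1)"

end

theory Submission
  imports Defs
begin

(* Expand -h(x^+) into a deterministic term, the loss w'Ew + 2(Ef(x))'w, and the linear loss
   2c'w with c = Eg(x)u. CVaR is subadditive and positively homogeneous, and the worst-case CVaR
   of -w_i equals that of w_i because the ambiguity set is invariant under w |-> -w. Since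
   |c_i| <= v_i and the worst-case CVaR of w_i is at least its mean 0, the loss c'w has worst-case
   CVaR at most the sum of v_i times the worst-case CVaR of w_i. *)

section \<open>Calculus of upper bounds for the CVaR\<close>

text \<open>An infimum lies strictly below \<open>c\<close> exactly when one of its values does, so
  a strict bound hands over a threshold \<beta> even where no minimiser is known. Truncation by
  \<open>ennreal\<close> is harmless: if \<open>c \<le> \<beta>\<close>, the right side is 0 and
  both inequalities fail.\<close>

lemma CVaR_less_iff:
  assumes "0 < \<epsilon>"
  shows "CVaR P \<epsilon> L < ereal c \<longleftrightarrow>
    (\<exists>\<beta>. (\<integral>\<^sup>+w. ennreal (max (L w - \<beta>) 0) \<partial>P) < ennreal (\<epsilon> * (c - \<beta>)))"
proof -
  have "ereal \<beta> + ereal (1 / \<epsilon>) * enn2ereal I < ereal c \<longleftrightarrow> I < ennreal (\<epsilon> * (c - \<beta>))"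
    for \<beta> and I :: ennreal
  proof (cases I)
    case (real t)
    have "ereal \<beta> + ereal (1 / \<epsilon>) * enn2ereal I < ereal c \<longleftrightarrow> \<beta> + t / \<epsilon> < c"
      using real by (simp add: enn2ereal_ennreal)
    also have "\<dots> \<longleftrightarrow> t < \<epsilon> * (c - \<beta>)"
      using assms by (simp add: field_simps)
    also have "\<dots> \<longleftrightarrow> I < ennreal (\<epsilon> * (c - \<beta>))"
      using real by (simp add: ennreal_less_iff)
    finally show ?thesis .
  qed (use assms in simp)
  then show ?thesis
    unfolding CVaR_def INF_less_iff by simp
qed

text \<open>Reduces a weak bound to strict ones with arbitrarily small slack, the form in which
  thresholds can be extracted.\<close>

lemma CVaR_le_iff:
  "CVaR P \<epsilon> L \<le> ereal a \<longleftrightarrow> (\<forall>c>a. CVaR P \<epsilon> L < ereal c)"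
proof
  assume *: "\<forall>c>a. CVaR P \<epsilon> L < ereal c"
  show "CVaR P \<epsilon> L \<le> ereal a"
  proof (rule ereal_le_epsilon2)
    fix e :: real assume "0 < e"
    then show "CVaR P \<epsilon> L \<le> ereal a + ereal e"
      using *[rule_format, of "a + e"] by (simp add: less_imp_le)
  qed
qed (auto intro: le_less_trans)

text \<open>Subadditivity: the sum of two nearly optimal thresholds serves the sum of the losses,
  because the positive part is subadditive. Each loss receives half of the slack
  \<open>c - (a + b)\<close>.\<close>

lemma CVaR_add_le:
  assumes "0 < \<epsilon>" and [measurable]: "A \<in> borel_measurable P" "B \<in> borel_measurable P"
    and "CVaR P \<epsilon> A \<le> ereal a" "CVaR P \<epsilon> B \<le> ereal b"
  shows "CVaR P \<epsilon> (\<lambda>w. A w + B w) \<le> ereal (a + b)"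
  unfolding CVaR_le_iff
proof (intro allI impI)
  fix c assume "a + b < c"
  define e where "e = (c - (a + b)) / 2"
  have "0 < e"
    using \<open>a + b < c\<close> by (simp add: e_def)
  then have "CVaR P \<epsilon> A < ereal (a + e)" "CVaR P \<epsilon> B < ereal (b + e)"
    using assms(4,5) by (simp_all add: CVaR_le_iff)
  then obtain \<alpha> \<beta> where
    A: "(\<integral>\<^sup>+w. ennreal (max (A w - \<alpha>) 0) \<partial>P) < ennreal (\<epsilon> * (a + e - \<alpha>))" and
    B: "(\<integral>\<^sup>+w. ennreal (max (B w - \<beta>) 0) \<partial>P) < ennreal (\<epsilon> * (b + e - \<beta>))"
    unfolding CVaR_less_iff[OF \<open>0 < \<epsilon>\<close>] by blast
  \<comment> \<open>Being strictly above an integral, both bounds are positive, so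
    \<open>ennreal\<close> has truncated neither and their sum can be taken in the reals.\<close>
  have "0 < ennreal (\<epsilon> * (a + e - \<alpha>))" "0 < ennreal (\<epsilon> * (b + e - \<beta>))"
    using le_less_trans[OF zero_le A] le_less_trans[OF zero_le B] by blast+
  then have nonneg: "0 \<le> \<epsilon> * (a + e - \<alpha>)" "0 \<le> \<epsilon> * (b + e - \<beta>)"
    by simp_all
  have "(\<integral>\<^sup>+w. ennreal (max (A w + B w - (\<alpha> + \<beta>)) 0) \<partial>P)
      \<le> (\<integral>\<^sup>+w. ennreal (max (A w - \<alpha>) 0) + ennreal (max (B w - \<beta>) 0) \<partial>P)"
    by (intro nn_integral_mono) (auto simp del: ennreal_max_0 ennreal_max_0'
        simp flip: ennreal_plus intro!: ennreal_leI)
  also have "\<dots> = (\<integral>\<^sup>+w. ennreal (max (A w - \<alpha>) 0) \<partial>P) + (\<integral>\<^sup>+w. ennreal (max (B w - \<beta>) 0) \<partial>P)"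
    by (intro nn_integral_add) simp_all
  also have "\<dots> < ennreal (\<epsilon> * (a + e - \<alpha>)) + ennreal (\<epsilon> * (b + e - \<beta>))"
    using A B by (rule add_strict_mono)
  also have "\<dots> = ennreal (\<epsilon> * (c - (\<alpha> + \<beta>)))"
    using nonneg by (simp add: e_def algebra_simps flip: ennreal_plus)
  finally show "CVaR P \<epsilon> (\<lambda>w. A w + B w) < ereal c"
    unfolding CVaR_less_iff[OF \<open>0 < \<epsilon>\<close>] by blast
qed

text \<open>The threshold \<open>c\<close> leaves no excess.\<close>

lemma CVaR_const_le: "CVaR P \<epsilon> (\<lambda>w. c) \<le> ereal c"
  unfolding CVaR_def by (rule INF_lower2[of c]) (simp_all add: zero_ennreal.rep_eq)

text \<open>Scaling loss and threshold by \<open>k\<close> scales the excess by \<open>k\<close>.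
  The proof divides by \<open>k\<close>, so the zero loss is treated apart.\<close>

lemma CVaR_cmult_le:
  assumes "0 < \<epsilon>" "0 \<le> k" and [measurable]: "A \<in> borel_measurable P"
    and "CVaR P \<epsilon> A \<le> ereal a"
  shows "CVaR P \<epsilon> (\<lambda>w. k * A w) \<le> ereal (k * a)"
proof (cases "k = 0")
  case True
  then show ?thesis
    using CVaR_const_le[of P \<epsilon> 0] by simp
next
  case False
  then have "0 < k"
    using assms by simp
  show ?thesis
    unfolding CVaR_le_iff
  proof (intro allI impI)
    fix c assume "k * a < c"
    then have "a < c / k"
      using \<open>0 < k\<close> by (simp add: field_simps)
    then obtain \<beta> where
      \<beta>: "(\<integral>\<^sup>+w. ennreal (max (A w - \<beta>) 0) \<partial>P) < ennreal (\<epsilon> * (c / k - \<beta>))"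
      using assms(4) unfolding CVaR_le_iff CVaR_less_iff[OF \<open>0 < \<epsilon>\<close>] by blast
    have "max (k * A w - k * \<beta>) 0 = k * max (A w - \<beta>) 0" for w
      using \<open>0 < k\<close> by (simp add: max_mult_distrib_left algebra_simps)
    then have "(\<integral>\<^sup>+w. ennreal (max (k * A w - k * \<beta>) 0) \<partial>P)
        = ennreal k * (\<integral>\<^sup>+w. ennreal (max (A w - \<beta>) 0) \<partial>P)"
      using \<open>0 < k\<close> by (simp add: ennreal_mult nn_integral_cmult)
    also have "\<dots> < ennreal k * ennreal (\<epsilon> * (c / k - \<beta>))"
      using \<open>0 < k\<close> \<beta> by (intro ennreal_mult_strict_left_mono) simp_all
    also have "\<dots> = ennreal (\<epsilon> * (c - k * \<beta>))"
      using \<open>0 < k\<close> by (simp add: right_diff_distrib mult.left_commute flip: ennreal_mult')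
    finally show "CVaR P \<epsilon> (\<lambda>w. k * A w) < ereal c"
      unfolding CVaR_less_iff[OF \<open>0 < \<epsilon>\<close>] by blast
  qed
qed

lemma CVaR_sum_le:
  assumes "0 < \<epsilon>" "finite I" "\<And>i. i \<in> I \<Longrightarrow> A i \<in> borel_measurable P"
    and "\<And>i. i \<in> I \<Longrightarrow> CVaR P \<epsilon> (A i) \<le> ereal (a i)"
  shows "CVaR P \<epsilon> (\<lambda>w. \<Sum>i\<in>I. A i w) \<le> ereal (\<Sum>i\<in>I. a i)"
  using assms(2-)
proof (induction I rule: finite_induct)
  case empty
  then show ?case
    using CVaR_const_le[of P \<epsilon> 0] by simp
next
  case (insert i I)
  then show ?case
    by (simp add: CVaR_add_le[OF \<open>0 < \<epsilon>\<close>])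
qed

text \<open>Every threshold gives at least the mean: \<open>L - \<beta>\<close> is at most its
  positive part, and dividing the expected positive part by \<epsilon> < 1 does not decrease
  it.\<close>

lemma CVaR_ge_expectation:
  assumes "prob_space P" "0 < \<epsilon>" "\<epsilon> < 1" "integrable P L"
  shows "ereal (\<integral>w. L w \<partial>P) \<le> CVaR P \<epsilon> L"
  unfolding CVaR_def
proof (rule INF_greatest)
  fix \<beta> :: real
  interpret prob_space P by fact
  let ?I = "\<integral>w. max (L w - \<beta>) 0 \<partial>P"
  have int: "integrable P (\<lambda>w. max (L w - \<beta>) 0)"
    using assms by simp
  have "(\<integral>w. L w \<partial>P) - \<beta> = (\<integral>w. L w - \<beta> \<partial>P)"
    using assms by (simp add: prob_space)
  also have "\<dots> \<le> ?I"
    using assms int by (intro integral_mono) auto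
  also have "\<dots> \<le> ?I / \<epsilon>"
    using assms mult_left_mono[of \<epsilon> 1 ?I] by (simp add: field_simps)
  finally have "(\<integral>w. L w \<partial>P) \<le> \<beta> + 1 / \<epsilon> * ?I"
    by simp
  moreover have "(\<integral>\<^sup>+w. ennreal (max (L w - \<beta>) 0) \<partial>P) = ennreal ?I"
    using int by (intro nn_integral_eq_integral) auto
  ultimately show "ereal (\<integral>w. L w \<partial>P)
      \<le> ereal \<beta> + ereal (1 / \<epsilon>) * enn2ereal (\<integral>\<^sup>+w. ennreal (max (L w - \<beta>) 0) \<partial>P)"
    by (simp add: enn2ereal_ennreal)
qed

text \<open>A crude bound from the threshold 0. It serves for finiteness: when the mean of
  \<open>M\<close> is fixed by the moments, the bound is uniform over the ambiguity set.\<close>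

lemma CVaR_le_expectation:
  assumes "0 < \<epsilon>" "integrable P M" "\<And>w. max (L w) 0 \<le> M w"
  shows "CVaR P \<epsilon> L \<le> ereal ((\<integral>w. M w \<partial>P) / \<epsilon>)"
proof -
  have M: "0 \<le> M w" for w
    using assms(3)[of w] by simp
  have "(\<integral>\<^sup>+w. ennreal (max (L w - 0) 0) \<partial>P) \<le> (\<integral>\<^sup>+w. ennreal (M w) \<partial>P)"
    using assms(3) by (intro nn_integral_mono ennreal_leI) simp
  also have "\<dots> = ennreal (\<integral>w. M w \<partial>P)"
    using assms(2) M by (intro nn_integral_eq_integral) auto
  finally have "enn2ereal (\<integral>\<^sup>+w. ennreal (max (L w - 0) 0) \<partial>P) \<le> ereal (\<integral>w. M w \<partial>P)"
    using M by (simp add: less_eq_ennreal.rep_eq enn2ereal_ennreal)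
  then have "ereal 0 + ereal (1 / \<epsilon>) * enn2ereal (\<integral>\<^sup>+w. ennreal (max (L w - 0) 0) \<partial>P)
      \<le> ereal 0 + ereal (1 / \<epsilon>) * ereal (\<integral>w. M w \<partial>P)"
    using assms(1) by (intro add_left_mono ereal_mult_left_mono) auto
  then show ?thesis
    unfolding CVaR_def by (intro INF_lower2[of 0]) simp_all
qed

lemma CVaR_distr:
  assumes "T \<in> measurable P N" "L \<in> borel_measurable N"
  shows "CVaR (distr P N T) \<epsilon> L = CVaR P \<epsilon> (\<lambda>w. L (T w))"
  using assms unfolding CVaR_def by (simp add: nn_integral_distr)

section \<open>The ambiguity set\<close>

text \<open>Since the mean is zero, covariances are plain second moments.\<close>

lemma ambiguity_setD:
  assumes "P \<in> ambiguity_set \<Sigma>"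
  shows "prob_space P" "sets P = sets borel" "integrable P (\<lambda>w. w)" "(\<integral>w. w \<partial>P) = 0"
    "integrable P (\<lambda>w. w $ i * w $ j)" "(\<integral>w. w $ i * w $ j \<partial>P) = \<Sigma> $ i $ j"
  using assms unfolding ambiguity_set_def has_mean_def has_covariance_def by auto

text \<open>Reflection negates the mean, which is zero, and leaves every product of two coordinates
  unchanged.\<close>

lemma uminus_ambiguity_set:
  fixes \<Sigma> :: "real^'n^'n"
  assumes "P \<in> ambiguity_set \<Sigma>"
  shows "distr P borel uminus \<in> ambiguity_set \<Sigma>"
proof -
  note P = ambiguity_setD[OF assms]
  interpret prob_space P by (rule P)
  have [measurable_cong]: "sets P = sets borel" by (rule P)
  have T: "(uminus :: real^'n \<Rightarrow> real^'n) \<in> measurable P borel"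
    by measurable
  have "prob_space (distr P borel uminus)"
    by (rule prob_space_distr) (rule T)
  moreover have "integrable (distr P borel uminus) (\<lambda>w. w)"
    by (subst integrable_distr_eq[OF T measurable_ident_sets[OF refl]])
      (rule Bochner_Integration.integrable_minus[OF P(3)])
  moreover have "(\<integral>w. w \<partial>distr P borel uminus) = 0"
    by (subst integral_distr[OF T measurable_ident_sets[OF refl]])
      (simp only: integral_minus P(4) minus_zero)
  moreover have "integrable (distr P borel uminus) (\<lambda>w. w $ i * w $ j)"
    "(\<integral>w. w $ i * w $ j \<partial>distr P borel uminus) = \<Sigma> $ i $ j" for i j
    using integrable_distr_eq[OF T, of "\<lambda>w. w $ i * w $ j"]
      integral_distr[OF T, of "\<lambda>w. w $ i * w $ j"] P(5,6)[of i j]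
    by simp_all
  ultimately show ?thesis
    by (simp add: ambiguity_set_def has_mean_def has_covariance_def)
qed

lemma norm_squared_ambiguity_set:
  fixes \<Sigma> :: "real^'n^'n"
  assumes "P \<in> ambiguity_set \<Sigma>"
  shows "integrable P (\<lambda>w. (norm w)\<^sup>2)" "(\<integral>w. (norm w)\<^sup>2 \<partial>P) = trace \<Sigma>"
proof -
  have "(norm w)\<^sup>2 = (\<Sum>i\<in>UNIV. w $ i * w $ i)" for w :: "real^'n"
    by (simp add: power2_norm_eq_inner inner_vec_def)
  then show "integrable P (\<lambda>w. (norm w)\<^sup>2)" "(\<integral>w. (norm w)\<^sup>2 \<partial>P) = trace \<Sigma>"
    using ambiguity_setD(5,6)[OF assms] by (simp_all add: trace_def)
qed

text \<open>Quadratic growth bounds the CVaR above by the same multiple of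
  \<open>1 + trace \<Sigma>\<close> for all members, and the mean under \<open>P\<close> bounds the
  supremum below. Hence \<open>real_of_ereal\<close> loses nothing.\<close>

lemma worst_CVaR_finite:
  fixes L :: "real^'n \<Rightarrow> real"
  assumes "P \<in> ambiguity_set \<Sigma>" "0 < \<epsilon>" "\<epsilon> < 1" "L \<in> borel_measurable borel"
    and growth: "\<And>w. \<bar>L w\<bar> \<le> B * (1 + (norm w)\<^sup>2)"
  shows "integrable P L"
    and "ereal (real_of_ereal (worst_CVaR (ambiguity_set \<Sigma>) \<epsilon> L)) = worst_CVaR (ambiguity_set \<Sigma>) \<epsilon> L"
proof -
  have int: "integrable Q (\<lambda>w. B * (1 + (norm w)\<^sup>2))"
    and val: "(\<integral>w. B * (1 + (norm w)\<^sup>2) \<partial>Q) = B * (1 + trace \<Sigma>)"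
    if "Q \<in> ambiguity_set \<Sigma>" for Q
  proof -
    interpret prob_space Q by (rule ambiguity_setD[OF that])
    show "integrable Q (\<lambda>w. B * (1 + (norm w)\<^sup>2))"
      "(\<integral>w. B * (1 + (norm w)\<^sup>2) \<partial>Q) = B * (1 + trace \<Sigma>)"
      using norm_squared_ambiguity_set[OF that] by (simp_all add: prob_space)
  qed
  have "L \<in> borel_measurable P"
    using assms(4) measurable_cong_sets[OF ambiguity_setD(2)[OF assms(1)] refl] by blast
  then show L: "integrable P L"
    using growth by (intro Bochner_Integration.integrable_bound[OF int[OF assms(1)]])
      (auto intro!: AE_I2 order_trans[OF _ abs_ge_self])
  have "max (L w) 0 \<le> B * (1 + (norm w)\<^sup>2)" for w
    using growth[of w] by linarith
  then have "worst_CVaR (ambiguity_set \<Sigma>) \<epsilon> L \<le> ereal (B * (1 + trace \<Sigma>) / \<epsilon>)"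
    unfolding worst_CVaR_def
    using CVaR_le_expectation[OF \<open>0 < \<epsilon>\<close> int] val by (intro SUP_least) metis
  \<comment> \<open>The member \<open>P\<close> keeps the supremum away from minus infinity, its
    value on an empty set.\<close>
  moreover have "ereal (\<integral>w. L w \<partial>P) \<le> worst_CVaR (ambiguity_set \<Sigma>) \<epsilon> L"
    unfolding worst_CVaR_def
    using CVaR_ge_expectation[OF ambiguity_setD(1)[OF assms(1)] assms(2,3) L] assms(1)
    by (intro SUP_upper2)
  ultimately show "ereal (real_of_ereal (worst_CVaR (ambiguity_set \<Sigma>) \<epsilon> L))
      = worst_CVaR (ambiguity_set \<Sigma>) \<epsilon> L"
    by (intro ereal_real') auto
qed

lemma CVaR_le_worst_CVaR:
  fixes L :: "real^'n \<Rightarrow> real"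
  assumes "P \<in> ambiguity_set \<Sigma>" "0 < \<epsilon>" "\<epsilon> < 1" "L \<in> borel_measurable borel"
    and "\<And>w. \<bar>L w\<bar> \<le> B * (1 + (norm w)\<^sup>2)"
  shows "CVaR P \<epsilon> L \<le> ereal (real_of_ereal (worst_CVaR (ambiguity_set \<Sigma>) \<epsilon> L))"
  by (subst worst_CVaR_finite(2)[OF assms]) (auto simp: worst_CVaR_def intro: SUP_upper assms(1))

section \<open>Growth bounds and the linear loss\<close>

lemma norm_le_growth: "norm w \<le> 1 + (norm w)\<^sup>2"
  \<comment> \<open>Expanding the square gives \<open>norm w \<le> (norm w)^2 + 1/4\<close>.\<close>
  using zero_le_power2[of "norm w - 1/2"] by (simp add: power2_eq_square algebra_simps)

lemma component_growth: "\<bar>w $ i\<bar> \<le> 1 * (1 + (norm w)\<^sup>2)" for w :: "real^'n"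
  using order_trans[OF component_le_norm_cart norm_le_growth] by simp

lemma quadratic_growth:
  fixes E :: "real^'n^'n"
  shows "\<bar>w \<bullet> (E *v w) + c \<bullet> w\<bar> \<le> (onorm ((*v) E) + norm c) * (1 + (norm w)\<^sup>2)"
proof -
  have "\<bar>w \<bullet> (E *v w)\<bar> \<le> norm w * norm (E *v w)"
    by (rule Cauchy_Schwarz_ineq2)
  also have "\<dots> \<le> norm w * (onorm ((*v) E) * norm w)"
    by (intro mult_left_mono onorm) simp_all
  also have "\<dots> \<le> onorm ((*v) E) * (1 + (norm w)\<^sup>2)"
    using onorm_pos_le[of "(*v) E"] by (simp add: power2_eq_square algebra_simps)
  finally have quad: "\<bar>w \<bullet> (E *v w)\<bar> \<le> onorm ((*v) E) * (1 + (norm w)\<^sup>2)" .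
  have "\<bar>c \<bullet> w\<bar> \<le> norm c * norm w"
    by (rule Cauchy_Schwarz_ineq2)
  also have "\<dots> \<le> norm c * (1 + (norm w)\<^sup>2)"
    using norm_le_growth[of w] by (intro mult_left_mono) simp_all
  finally show ?thesis
    using quad by (simp add: distrib_right)
qed

text \<open>Handled coordinatewise: \<open>c $ i * w $ i\<close> is \<open>\<bar>c $ i\<bar>\<close>
  times either \<open>w $ i\<close> or its negative, and one number bounds the CVaR of both. That
  number is nonnegative, so \<open>\<bar>c $ i\<bar>\<close> may be enlarged to
  \<open>v $ i\<close>.\<close>

lemma CVaR_linear_le:
  fixes c v :: "real^'n"
  assumes P: "P \<in> ambiguity_set \<Sigma>" and \<epsilon>: "0 < \<epsilon>" "\<epsilon> < 1" and c: "\<And>i. \<bar>c $ i\<bar> \<le> v $ i"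
  shows "CVaR P \<epsilon> (\<lambda>w. c \<bullet> w) \<le> ereal (v \<bullet> worst_CVaR_vec (ambiguity_set \<Sigma>) \<epsilon>)"
proof -
  define d where "d = worst_CVaR_vec (ambiguity_set \<Sigma>) \<epsilon>"
  have [measurable_cong]: "sets P = sets borel"
    by (rule ambiguity_setD[OF P])
  have upper: "CVaR Q \<epsilon> (\<lambda>w. w $ i) \<le> ereal (d $ i)" if "Q \<in> ambiguity_set \<Sigma>" for Q i
    unfolding d_def worst_CVaR_vec_def vec_lambda_beta
    by (rule CVaR_le_worst_CVaR[OF that \<epsilon> _ component_growth]) simp
  \<comment> \<open>The loss \<open>- w $ i\<close> under \<open>P\<close> is the loss
    \<open>w $ i\<close> under the reflected law, again a member.\<close>
  have upper_neg: "CVaR P \<epsilon> (\<lambda>w. - w $ i) \<le> ereal (d $ i)" for i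
  proof -
    have "CVaR P \<epsilon> (\<lambda>w. - w $ i) = CVaR (distr P borel uminus) \<epsilon> (\<lambda>w. w $ i)"
      by (subst CVaR_distr) simp_all
    then show ?thesis
      using upper[OF uminus_ambiguity_set[OF P], of i] by simp
  qed
  \<comment> \<open>The mean of \<open>w $ i\<close> is 0 and bounds its CVaR from below.\<close>
  have d_nonneg: "0 \<le> d $ i" for i
  proof -
    have "(\<integral>w. w $ i \<partial>P) = (\<integral>w. w \<partial>P) $ i"
      using integral_bounded_linear[OF bounded_linear_vec_nth ambiguity_setD(3)[OF P]] .
    moreover have "integrable P (\<lambda>w. w $ i)"
      using integrable_bounded_linear[OF bounded_linear_vec_nth ambiguity_setD(3)[OF P]] .
    ultimately have "0 \<le> CVaR P \<epsilon> (\<lambda>w. w $ i)"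
      using CVaR_ge_expectation[OF ambiguity_setD(1)[OF P] \<epsilon>, of "\<lambda>w. w $ i"] ambiguity_setD(4)[OF P]
      by (simp add: zero_ereal_def)
    then have "ereal 0 \<le> ereal (d $ i)"
      unfolding zero_ereal_def using upper[OF P] by (rule order_trans)
    then show ?thesis
      by simp
  qed
  have "CVaR P \<epsilon> (\<lambda>w. c $ i * w $ i) \<le> ereal (v $ i * d $ i)" for i
  proof -
    \<comment> \<open>The sign of \<open>c $ i\<close> moves into the loss, since positive
      homogeneity needs a nonnegative factor.\<close>
    have "CVaR P \<epsilon> (\<lambda>w. \<bar>c $ i\<bar> * (if 0 \<le> c $ i then w $ i else - w $ i)) \<le> ereal (\<bar>c $ i\<bar> * d $ i)"
      using upper[OF P, of i] upper_neg[of i] by (intro CVaR_cmult_le \<epsilon>; cases "0 \<le> c $ i") simp_all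
    also have "(\<lambda>w. \<bar>c $ i\<bar> * (if 0 \<le> c $ i then w $ i else - w $ i)) = (\<lambda>w. c $ i * w $ i)"
      by auto
    also have "ereal (\<bar>c $ i\<bar> * d $ i) \<le> ereal (v $ i * d $ i)"
      using c d_nonneg by (simp add: mult_right_mono)
    finally show ?thesis .
  qed
  then have "CVaR P \<epsilon> (\<lambda>w. \<Sum>i\<in>UNIV. c $ i * w $ i) \<le> ereal (\<Sum>i\<in>UNIV. v $ i * d $ i)"
    by (intro CVaR_sum_le \<epsilon>) simp_all
  then show ?thesis
    by (simp add: inner_vec_def d_def)
qed

section \<open>Concatenated vectors and block matrices\<close>

lemma minus_matrix_vector_mult: "(- A) *v x = - (A *v x)" for A :: "real^'n^'m"
  using matrix_vector_mult_diff_rdistrib[of 0 A x] by simp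

lemma sum_UNIV_Plus:
  fixes F :: "'a::finite + 'b::finite \<Rightarrow> 'c::comm_monoid_add"
  shows "(\<Sum>k\<in>UNIV. F k) = (\<Sum>i\<in>UNIV. F (Inl i)) + (\<Sum>j\<in>UNIV. F (Inr j))"
  unfolding UNIV_Plus_UNIV[symmetric] by (subst sum.Plus) simp_all

lemma inner_vec_concat: "vec_concat a b \<bullet> vec_concat c d = a \<bullet> c + b \<bullet> d"
  for a c :: "real^'m" and b d :: "real^'n"
  by (simp add: inner_vec_def vec_concat_def sum_UNIV_Plus)

lemma block_mat_mult_vec_concat:
  fixes A :: "real^'c^'p" and B :: "real^'d^'p" and C :: "real^'c^'q" and D :: "real^'d^'q"
  shows "block_mat A B C D *v vec_concat a b = vec_concat (A *v a + B *v b) (C *v a + D *v b)"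
  unfolding vec_eq_iff
proof
  fix k :: "'p + 'q"
  show "(block_mat A B C D *v vec_concat a b) $ k
      = vec_concat (A *v a + B *v b) (C *v a + D *v b) $ k"
    by (cases k) (simp_all add: matrix_vector_mult_def block_mat_def vec_concat_def sum_UNIV_Plus)
qed

section \<open>Combining the two constraints with the expansion of the loss\<close>

theorem mainTheorem6:
  fixes f :: "real^'n \<Rightarrow> real^'n"
    and g :: "real^'n \<Rightarrow> real^'m^'n"
    and \<epsilon> \<alpha> r :: real
    and \<Sigma>\<^sub>w E :: "real^'n^'n"
    and x v :: "real^'n"
    and u :: "real^'m"
  defines "\<P> \<equiv> ambiguity_set \<Sigma>\<^sub>w"
    and "ubar \<equiv> vec_concat u v"
  assumes "continuous_on UNIV f"
    and "continuous_on UNIV g"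
    and "0 < \<epsilon>" and "\<epsilon> < 1"
    and "0 \<le> \<alpha>" and "\<alpha> \<le> 1"
    and "pos_def \<Sigma>\<^sub>w"
    and "pos_def E"
    and "ubar \<bullet> (H_bar g E x *v ubar) + q_bar f g E \<P> \<epsilon> x \<bullet> ubar + r_bar f E r \<alpha> \<P> \<epsilon> x \<le> 0"
    and "\<forall>k. (A_bar g E x *v ubar) $ k \<le> 0"
  shows "worst_CVaR \<P> \<epsilon> (\<lambda>w. - h_fun E r (f x + g x *v u + w)) \<le> ereal (- \<alpha> * h_fun E r x)"
proof -
  define p where "p = f x"
  define q where "q = g x *v u"
  define c where "c = E *v q"
  define d where "d = worst_CVaR_vec \<P> \<epsilon>"
  define L where "L = (\<lambda>w. w \<bullet> (E *v w) + (2 *\<^sub>R (E *v p)) \<bullet> w)"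
  define l where "l = real_of_ereal (worst_CVaR \<P> \<epsilon> L)"
  define k where "k = (p + q) \<bullet> (E *v (p + q)) - r"
  note \<epsilon> = \<open>0 < \<epsilon>\<close> \<open>\<epsilon> < 1\<close>
  have sym: "a \<bullet> (E *v b) = b \<bullet> (E *v a)" for a b
    using \<open>pos_def E\<close> dot_lmul_matrix[of a E b]
    by (simp add: pos_def_def inner_commute flip: transpose_matrix_vector)
  \<comment> \<open>The two blocks say \<open>c \<le> v\<close> and \<open>- c \<le> v\<close>
    coordinatewise; together they bound the absolute values of \<open>c\<close> by
    \<open>v\<close>.\<close>
  have A_bar_mult: "A_bar g E x *v ubar = vec_concat (c - v) (- c - v)"
    unfolding A_bar_def ubar_def block_mat_mult_vec_concat
    by (simp add: c_def q_def minus_matrix_vector_mult flip: matrix_vector_mul_assoc)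
  have c: "\<bar>c $ i\<bar> \<le> v $ i" for i
    using assms(12)[rule_format, of "Inl i"] assms(12)[rule_format, of "Inr i"]
    unfolding A_bar_mult by (simp add: vec_concat_def)
  have adjoint: "u \<bullet> (transpose (g x) *v a) = q \<bullet> a" for a
    using dot_lmul_matrix[of a "g x" u] by (simp add: q_def inner_commute)
  have "ubar \<bullet> (H_bar g E x *v ubar) = q \<bullet> (E *v q)"
    unfolding H_bar_def ubar_def block_mat_mult_vec_concat inner_vec_concat
    using adjoint by (simp add: q_def flip: matrix_vector_mul_assoc del: transpose_matrix_vector)
  moreover have "q_bar f g E \<P> \<epsilon> x \<bullet> ubar = 2 * (q \<bullet> (E *v p) + v \<bullet> d)"
    unfolding q_bar_def ubar_def inner_scaleR_left inner_vec_concat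
    using adjoint by (simp add: p_def d_def inner_commute del: transpose_matrix_vector)
  \<comment> \<open>The sign changes because \<open>x \<bullet> (E *v x) - r\<close> is
    \<open>- h_fun E r x\<close>.\<close>
  moreover have "r_bar f E r \<alpha> \<P> \<epsilon> x = l + p \<bullet> (E *v p) - r + \<alpha> * h_fun E r x"
    by (simp add: r_bar_def h_fun_def l_def L_def p_def algebra_simps)
  moreover have "k = p \<bullet> (E *v p) + 2 * (q \<bullet> (E *v p)) + q \<bullet> (E *v q) - r"
    using sym[of p q] by (simp add: k_def matrix_vector_right_distrib inner_add_left inner_add_right)
  \<comment> \<open>The left side of the first constraint is
    \<open>k + l + 2 * (v \<bullet> d) + \<alpha> * h_fun E r x\<close>.\<close>
  ultimately have bound: "k + (l + 2 * (v \<bullet> d)) \<le> - \<alpha> * h_fun E r x"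
    using assms(11) by simp
  \<comment> \<open>By symmetry of \<open>E\<close>, the terms linear in \<open>w\<close> are
    \<open>2 * (w \<bullet> (E *v (p + q)))\<close>. The part from \<open>p\<close> stays inside
    \<open>L\<close>, where its CVaR is taken jointly with the quadratic term; the part from
    \<open>q\<close> is the loss controlled by \<open>v\<close>.\<close>
  have expand: "- h_fun E r (f x + g x *v u + w) = k + (L w + 2 * (c \<bullet> w))" for w
    unfolding p_def[symmetric] q_def[symmetric]
    using sym[of w "p + q"] inner_commute[of w "E *v p"] inner_commute[of w "E *v q"]
    by (simp add: h_fun_def k_def L_def c_def matrix_vector_right_distrib inner_add_left inner_add_right)
  have L_borel: "L \<in> borel_measurable borel"
    unfolding L_def by (intro borel_measurable_continuous_onI continuous_intros)
  \<comment> \<open>Fixing \<open>P\<close> first also supplies the member of the ambiguity set that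
    the finiteness argument requires.\<close>
  have "CVaR P \<epsilon> (\<lambda>w. - h_fun E r (f x + g x *v u + w)) \<le> ereal (- \<alpha> * h_fun E r x)"
    if "P \<in> \<P>" for P
  proof -
    have P: "P \<in> ambiguity_set \<Sigma>\<^sub>w"
      using that by (simp add: \<P>_def)
    note [measurable_cong] = ambiguity_setD(2)[OF P]
    have "CVaR P \<epsilon> L \<le> ereal l"
      unfolding l_def \<P>_def
      by (rule CVaR_le_worst_CVaR[OF P \<epsilon> L_borel]) (unfold L_def, rule quadratic_growth)
    moreover have "CVaR P \<epsilon> (\<lambda>w. 2 * (c \<bullet> w)) \<le> ereal (2 * (v \<bullet> d))"
      unfolding d_def \<P>_def by (intro CVaR_cmult_le CVaR_linear_le[OF P] \<epsilon> c) simp_all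
    ultimately have "CVaR P \<epsilon> (\<lambda>w. k + (L w + 2 * (c \<bullet> w))) \<le> ereal (k + (l + 2 * (v \<bullet> d)))"
      using L_borel by (intro CVaR_add_le CVaR_const_le \<epsilon>) simp_all
    also have "\<dots> \<le> ereal (- \<alpha> * h_fun E r x)"
      using bound by simp
    finally show ?thesis
      unfolding expand .
  qed
  then show ?thesis
    unfolding worst_CVaR_def by (rule SUP_least)
qed

end
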